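(* Let $M$ be a 7-dimensional manifold with an arbitrary $G_2^*$ structure $\varphi$, let $\xi$ be a vector field on $M$ with $g_{4,3}(\xi,\xi)=-1$, and let $(\phi,\xi,\eta,g)$ be the almost paracontact metric structure induced by $\varphi$ and $\xi$. If the component $F^{W_2}$ of $\nabla\Phi$ vanishes identically, then $\nabla_{\phi X}\xi=0$ for all vector fields $X$.
   Context: $G_2^*$ structures: on $\mathbb{R}^7$ with standard basis $e_1,\dots,e_7$ and dual basis $e^1,\dots,e^7$, let $g_{4,3}$ be the metric of signature $(-,-,-,-,+,+,+)$ for which the basis is orthonormal (the first four vectors having square $-1$), and let $\varphi_0=-e^{127}-e^{135}+e^{146}+e^{236}+e^{245}-e^{347}+e^{567}$, where $e^{ijk}=e^i\wedge e^j\wedge e^k$. $G_2^*$ is the stabilizer of $\varphi_0$ in $GL(7,\mathbb{R})$; it preserves $g_{4,3}$. A $G_2^*$ structure on a smooth oriented 7-manifold $M$ is a smooth 3-form $\varphi$ such that $(T_pM,\varphi_p)$ is isomorphic to $(\mathbb{R}^7,\varphi_0)$ for every $p\in M$. It induces a semi-Riemannian metric, also denoted $g_{4,3}$ (transported pointwise through these isomorphisms), and a cross product $P$ defined by $\varphi(X,Y,Z)=g_{4,3}(P(X,Y),Z)$. Induced almost paracontact metric structure: given a vector field $\xi$ with $g_{4,3}(\xi,\xi)=-1$, set $\phi(X)=P(\xi,X)$, $g=-g_{4,3}$, $\eta(X)=g(\xi,X)$. Then $\phi^2=I-\eta\otimes\xi$, $\eta(\xi)=1$, $g(\phi X,\phi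 Y)=-g(X,Y)+\eta(X)\eta(Y)$. The metrics $g$ and $g_{4,3}$ have the same Levi-Civita connection $\nabla$. The fundamental 2-form is $\Phi(X,Y)=g(\phi X,Y)$ and $F(X,Y,Z)=(\nabla_X\Phi)(Y,Z)$. The component (projection) of $F$ on $W_2=\mathbb{G}_5\oplus\mathbb{G}_6\oplus\cdots\oplus\mathbb{G}_{10}$ in the classification of almost paracontact metric structures is $$F^{W_2}(X,Y,Z)=-\eta(Y)F(\phi^2X,\phi^2Z,\xi)+\eta(Z)F(\phi^2X,\phi^2Y,\xi).$$ *)

theory Defs
  imports "HOL-Analysis.Analysis"
begin

section \<open>Smooth manifolds modelled on $R^7$\<close>

text \<open>
  A manifold is a Hausdorff, second countable type together with an atlas. The predicate
  \<open>Ck_on k f S\<close> is meant for open \<open>S\<close> only.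
\<close>

primrec Ck_on :: "nat \<Rightarrow> ('a::euclidean_space \<Rightarrow> 'b::real_normed_vector) \<Rightarrow> 'a set \<Rightarrow> bool" where
  "Ck_on 0 f S \<longleftrightarrow> continuous_on S f"
| "Ck_on (Suc k) f S \<longleftrightarrow> f differentiable_on S \<and>
     (\<forall>i\<in>Basis. Ck_on k (\<lambda>x. frechet_derivative f (at x) i) S)"

definition smooth_on :: "('a::euclidean_space \<Rightarrow> 'b::real_normed_vector) \<Rightarrow> 'a set \<Rightarrow> bool" where
  "smooth_on f S \<longleftrightarrow> (\<forall>k. Ck_on k f S)"

type_synonym 'm chart = "'m set \<times> ('m \<Rightarrow> real^7)"

definition is_chart :: "('m::topological_space) chart \<Rightarrow> bool" where
  "is_chart c \<longleftrightarrow> (case c of (U, x) \<Rightarrow>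
     open U \<and> open (x ` U) \<and> homeomorphism U (x ` U) x (inv_into U x))"

definition transition :: "('m::topological_space) chart \<Rightarrow> 'm chart \<Rightarrow> real^7 \<Rightarrow> real^7" where
  "transition c d = snd d \<circ> inv_into (fst c) (snd c)"

definition smooth_atlas :: "('m::topological_space) chart set \<Rightarrow> bool" where
  "smooth_atlas A \<longleftrightarrow> (\<forall>c\<in>A. is_chart c) \<and> (\<Union>c\<in>A. fst c) = UNIV \<and>
     (\<forall>c\<in>A. \<forall>d\<in>A. smooth_on (transition c d) (snd c ` (fst c \<inter> fst d)))"

definition oriented_smooth_atlas :: "('m::topological_space) chart set \<Rightarrow> bool" where
  "oriented_smooth_atlas A \<longleftrightarrow> smooth_atlas A \<and>
     (\<forall>c\<in>A. \<forall>d\<in>A. \<forall>a \<in> snd c ` (fst c \<inter> fst d).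
        det (matrix (frechet_derivative (transition c d) (at a))) > 0)"

definition smooth_functions :: "('m::topological_space) chart set \<Rightarrow> ('m \<Rightarrow> real) set" where
  "smooth_functions A = {f. \<forall>(U, x)\<in>A. smooth_on (f \<circ> inv_into U x) (x ` U)}"


section \<open>Tangent vectors and vector fields\<close>

type_synonym 'm tvec = "('m \<Rightarrow> real) \<Rightarrow> real"
type_synonym 'm vfield = "'m \<Rightarrow> 'm tvec"

text \<open>
  Tangent vectors at \<open>p\<close> are the derivations at \<open>p\<close> of the algebra of smooth functions,
  extended by 0 to non-smooth functions so that equal derivations are equal HOL functions.
\<close>

definition tangent_space :: "('m::topological_space) chart set \<Rightarrow> 'm \<Rightarrow> 'm tvec set" where
  "tangent_space A p = {v.
     (\<forall>f\<in>smooth_functions A. \<forall>h\<in>smooth_functions A. \<forall>a b.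
        v (\<lambda>q. a * f q + b * h q) = a * v f + b * v h) \<and>
     (\<forall>f\<in>smooth_functions A. \<forall>h\<in>smooth_functions A.
        v (\<lambda>q. f q * h q) = v f * h p + f p * v h) \<and>
     (\<forall>f. f \<notin> smooth_functions A \<longrightarrow> v f = 0)}"

definition vector_fields :: "('m::topological_space) chart set \<Rightarrow> 'm vfield set" where
  "vector_fields A = {X. (\<forall>p. X p \<in> tangent_space A p) \<and>
     (\<forall>f\<in>smooth_functions A. (\<lambda>p. X p f) \<in> smooth_functions A)}"

definition tangent_linear ::
  "('m::topological_space) chart set \<Rightarrow> 'm \<Rightarrow> ('m tvec \<Rightarrow> 'b::real_vector) \<Rightarrow> bool" where
  "tangent_linear A p L \<longleftrightarrow> (\<forall>v\<in>tangent_space A p. \<forall>w\<in>tangent_space A p. \<forall>a b.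
     L (\<lambda>f. a * v f + b * w f) = a *\<^sub>R L v + b *\<^sub>R L w)"

definition lie_bracket :: "'m vfield \<Rightarrow> 'm vfield \<Rightarrow> 'm vfield" where
  "lie_bracket X Y = (\<lambda>p f. X p (\<lambda>q. Y q f) - Y p (\<lambda>q. X q f))"


section \<open>Semi-Riemannian metrics and the Levi-Civita connection\<close>

definition semi_riemannian_metric ::
  "('m::topological_space) chart set \<Rightarrow> ('m \<Rightarrow> 'm tvec \<Rightarrow> 'm tvec \<Rightarrow> real) \<Rightarrow> bool" where
  "semi_riemannian_metric A g \<longleftrightarrow>
     (\<forall>p. \<forall>v\<in>tangent_space A p. tangent_linear A p (g p v)) \<and>
     (\<forall>p. \<forall>v\<in>tangent_space A p. \<forall>w\<in>tangent_space A p. g p v w = g p w v) \<and>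
     (\<forall>p. \<forall>v\<in>tangent_space A p.
        (\<forall>w\<in>tangent_space A p. g p v w = 0) \<longrightarrow> v = (\<lambda>_. 0)) \<and>
     (\<forall>X\<in>vector_fields A. \<forall>Y\<in>vector_fields A.
        (\<lambda>p. g p (X p) (Y p)) \<in> smooth_functions A)"

text \<open>
  A connection \<open>D\<close> takes a point \<open>p\<close>, a tangent vector \<open>v\<close> at \<open>p\<close> and a vector field \<open>Y\<close>
  to the covariant derivative of \<open>Y\<close> in direction \<open>v\<close>, a tangent vector at \<open>p\<close>. Thus
  $\nabla_X Y$ is \<open>\<lambda>p. D p (X p) Y\<close>, and tensoriality in \<open>X\<close> is built into the type.
\<close>

type_synonym 'm connection = "'m \<Rightarrow> 'm tvec \<Rightarrow> 'm vfield \<Rightarrow> 'm tvec"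

definition affine_connection ::
  "('m::topological_space) chart set \<Rightarrow> 'm connection \<Rightarrow> bool" where
  "affine_connection A D \<longleftrightarrow>
     (\<forall>p. \<forall>v\<in>tangent_space A p. \<forall>Y\<in>vector_fields A. D p v Y \<in> tangent_space A p) \<and>
     (\<forall>p. \<forall>v\<in>tangent_space A p. \<forall>w\<in>tangent_space A p. \<forall>Y\<in>vector_fields A. \<forall>a b.
        D p (\<lambda>h. a * v h + b * w h) Y = (\<lambda>h. a * D p v Y h + b * D p w Y h)) \<and>
     (\<forall>p. \<forall>v\<in>tangent_space A p. \<forall>Y\<in>vector_fields A. \<forall>Z\<in>vector_fields A.
        D p v (\<lambda>q h. Y q h + Z q h) = (\<lambda>h. D p v Y h + D p v Z h)) \<and>
     (\<forall>p. \<forall>v\<in>tangent_space A p. \<forall>f\<in>smooth_functions A. \<forall>Y\<in>vector_fields A.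
        D p v (\<lambda>q h. f q * Y q h) = (\<lambda>h. v f * Y p h + f p * D p v Y h)) \<and>
     (\<forall>X\<in>vector_fields A. \<forall>Y\<in>vector_fields A. (\<lambda>p. D p (X p) Y) \<in> vector_fields A)"

definition torsion_free :: "('m::topological_space) chart set \<Rightarrow> 'm connection \<Rightarrow> bool" where
  "torsion_free A D \<longleftrightarrow> (\<forall>X\<in>vector_fields A. \<forall>Y\<in>vector_fields A. \<forall>p.
     (\<lambda>f. D p (X p) Y f - D p (Y p) X f) = lie_bracket X Y p)"

definition metric_compatible ::
  "('m::topological_space) chart set \<Rightarrow> ('m \<Rightarrow> 'm tvec \<Rightarrow> 'm tvec \<Rightarrow> real) \<Rightarrow>
    'm connection \<Rightarrow> bool" where
  "metric_compatible A g D \<longleftrightarrow>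
     (\<forall>X\<in>vector_fields A. \<forall>Y\<in>vector_fields A. \<forall>Z\<in>vector_fields A. \<forall>p.
        X p (\<lambda>q. g q (Y q) (Z q)) = g p (D p (X p) Y) (Z p) + g p (Y p) (D p (X p) Z))"

definition levi_civita_connection ::
  "('m::topological_space) chart set \<Rightarrow> ('m \<Rightarrow> 'm tvec \<Rightarrow> 'm tvec \<Rightarrow> real) \<Rightarrow>
    'm connection \<Rightarrow> bool" where
  "levi_civita_connection A g D \<longleftrightarrow> semi_riemannian_metric A g \<and>
     affine_connection A D \<and> torsion_free A D \<and> metric_compatible A g D"

text \<open>Covariant derivative $(\nabla_X B)(Y,Z)$ of a (0,2)-tensor field \<open>B\<close>, evaluated at \<open>p\<close>.\<close>

definition cov_deriv2 ::
  "'m connection \<Rightarrow> ('m \<Rightarrow> 'm tvec \<Rightarrow> 'm tvec \<Rightarrow> real) \<Rightarrow>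
    'm vfield \<Rightarrow> 'm vfield \<Rightarrow> 'm vfield \<Rightarrow> 'm \<Rightarrow> real" where
  "cov_deriv2 D B X Y Z p =
     X p (\<lambda>q. B q (Y q) (Z q)) - B p (D p (X p) Y) (Z p) - B p (Y p) (D p (X p) Z)"


section \<open>The linear model of $G_2^*$\<close>

text \<open>
  The index type \<open>7\<close> is arithmetic modulo 7, so its elements are 1, ..., 6 and 7 = 0.
\<close>

definition g0 :: "real^7 \<Rightarrow> real^7 \<Rightarrow> real" where
  "g0 x y = - x$1 * y$1 - x$2 * y$2 - x$3 * y$3 - x$4 * y$4 + x$5 * y$5 + x$6 * y$6 + x$7 * y$7"

text \<open>Wedge products follow the determinant convention, i.e. $e^{ijk}(e_i,e_j,e_k) = 1$.\<close>

definition wedge3 :: "7 \<Rightarrow> 7 \<Rightarrow> 7 \<Rightarrow> real^7 \<Rightarrow> real^7 \<Rightarrow> real^7 \<Rightarrow> real" where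
  "wedge3 i j k x y z =
     det (vector [vector [x$i, x$j, x$k], vector [y$i, y$j, y$k], vector [z$i, z$j, z$k]] :: real^3^3)"

definition phi0 :: "real^7 \<Rightarrow> real^7 \<Rightarrow> real^7 \<Rightarrow> real" where
  "phi0 x y z =
     - wedge3 1 2 7 x y z - wedge3 1 3 5 x y z + wedge3 1 4 6 x y z + wedge3 2 3 6 x y z
     + wedge3 2 4 5 x y z - wedge3 3 4 7 x y z + wedge3 5 6 7 x y z"


section \<open>$G_2^*$ structures\<close>

type_synonym 'm form3 = "'m \<Rightarrow> 'm tvec \<Rightarrow> 'm tvec \<Rightarrow> 'm tvec \<Rightarrow> real"

definition smooth_three_form ::
  "('m::topological_space) chart set \<Rightarrow> 'm form3 \<Rightarrow> bool" where
  "smooth_three_form A \<omega> \<longleftrightarrow>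
     (\<forall>p. \<forall>u\<in>tangent_space A p. \<forall>v\<in>tangent_space A p.
        tangent_linear A p (\<lambda>w. \<omega> p w u v) \<and>
        tangent_linear A p (\<lambda>w. \<omega> p u w v) \<and>
        tangent_linear A p (\<lambda>w. \<omega> p u v w) \<and>
        \<omega> p u u v = 0 \<and> \<omega> p u v u = 0 \<and> \<omega> p v u u = 0) \<and>
     (\<forall>X\<in>vector_fields A. \<forall>Y\<in>vector_fields A. \<forall>Z\<in>vector_fields A.
        (\<lambda>p. \<omega> p (X p) (Y p) (Z p)) \<in> smooth_functions A)"

text \<open>Linear isomorphisms from the tangent space at \<open>p\<close>, with the value of \<open>\<omega>\<close>, to the model.\<close>

definition g2star_frame ::
  "('m::topological_space) chart set \<Rightarrow> 'm form3 \<Rightarrow> 'm \<Rightarrow> ('m tvec \<Rightarrow> real^7) \<Rightarrow> bool" where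
  "g2star_frame A \<omega> p L \<longleftrightarrow>
     tangent_linear A p L \<and> bij_betw L (tangent_space A p) UNIV \<and>
     (\<forall>u\<in>tangent_space A p. \<forall>v\<in>tangent_space A p. \<forall>w\<in>tangent_space A p.
        \<omega> p u v w = phi0 (L u) (L v) (L w))"

definition g2star_structure ::
  "('m::topological_space) chart set \<Rightarrow> 'm form3 \<Rightarrow> bool" where
  "g2star_structure A \<omega> \<longleftrightarrow> smooth_three_form A \<omega> \<and> (\<forall>p. \<exists>L. g2star_frame A \<omega> p L)"

text \<open>
  Two frames at the same point differ by an element of the stabilizer of \<open>phi0\<close>, which
  preserves \<open>g0\<close>; hence the metric below does not depend on the choice of the frame.
\<close>

definition g43 ::
  "('m::topological_space) chart set \<Rightarrow> 'm form3 \<Rightarrow> 'm \<Rightarrow> 'm tvec \<Rightarrow> 'm tvec \<Rightarrow> real" where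
  "g43 A \<omega> p v w = (let L = (SOME L. g2star_frame A \<omega> p L) in g0 (L v) (L w))"

definition cross_product ::
  "('m::topological_space) chart set \<Rightarrow> 'm form3 \<Rightarrow> 'm \<Rightarrow> 'm tvec \<Rightarrow> 'm tvec \<Rightarrow> 'm tvec" where
  "cross_product A \<omega> p u v = (THE w. w \<in> tangent_space A p \<and>
     (\<forall>z\<in>tangent_space A p. \<omega> p u v z = g43 A \<omega> p w z))"


section \<open>The induced almost paracontact metric structure\<close>

definition para_phi ::
  "('m::topological_space) chart set \<Rightarrow> 'm form3 \<Rightarrow> 'm vfield \<Rightarrow> 'm \<Rightarrow> 'm tvec \<Rightarrow> 'm tvec" where
  "para_phi A \<omega> \<xi> p v = cross_product A \<omega> p (\<xi> p) v"

definition para_metric ::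
  "('m::topological_space) chart set \<Rightarrow> 'm form3 \<Rightarrow> 'm \<Rightarrow> 'm tvec \<Rightarrow> 'm tvec \<Rightarrow> real" where
  "para_metric A \<omega> p v w = - g43 A \<omega> p v w"

definition para_eta ::
  "('m::topological_space) chart set \<Rightarrow> 'm form3 \<Rightarrow> 'm vfield \<Rightarrow> 'm \<Rightarrow> 'm tvec \<Rightarrow> real" where
  "para_eta A \<omega> \<xi> p v = para_metric A \<omega> p (\<xi> p) v"

definition para_Phi ::
  "('m::topological_space) chart set \<Rightarrow> 'm form3 \<Rightarrow> 'm vfield \<Rightarrow>
    'm \<Rightarrow> 'm tvec \<Rightarrow> 'm tvec \<Rightarrow> real" where
  "para_Phi A \<omega> \<xi> p v w = para_metric A \<omega> p (para_phi A \<omega> \<xi> p v) w"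

definition para_F ::
  "('m::topological_space) chart set \<Rightarrow> 'm form3 \<Rightarrow> 'm vfield \<Rightarrow> 'm connection \<Rightarrow>
    'm vfield \<Rightarrow> 'm vfield \<Rightarrow> 'm vfield \<Rightarrow> 'm \<Rightarrow> real" where
  "para_F A \<omega> \<xi> D = cov_deriv2 D (para_Phi A \<omega> \<xi>)"

definition para_F_W2 ::
  "('m::topological_space) chart set \<Rightarrow> 'm form3 \<Rightarrow> 'm vfield \<Rightarrow> 'm connection \<Rightarrow>
    'm vfield \<Rightarrow> 'm vfield \<Rightarrow> 'm vfield \<Rightarrow> 'm \<Rightarrow> real" where
  "para_F_W2 A \<omega> \<xi> D X Y Z p =
     (let sq = (\<lambda>V q. para_phi A \<omega> \<xi> q (para_phi A \<omega> \<xi> q (V q))) in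
        - para_eta A \<omega> \<xi> p (Y p) * para_F A \<omega> \<xi> D (sq X) (sq Z) \<xi> p
        + para_eta A \<omega> \<xi> p (Z p) * para_F A \<omega> \<xi> D (sq X) (sq Y) \<xi> p)"

end

theory Submission
  imports Defs
begin

text \<open>
  For $Z = \xi$ the hypothesis reads $F(\phi^2 X, \phi^2 Y, \xi) = 0$. Since
  $\Phi(\cdot, \xi) = 0$, the left side equals $-g(\phi Y, \nabla_{\phi^2 X}\xi)$. Moreover
  $g(\xi, \nabla\xi) = 0$ because $g(\xi,\xi)$ is constant, and $\xi$ together with the image of
  $\phi$ spans the tangent space, so nondegeneracy gives $\nabla_{\phi^2 X}\xi = 0$. Applying
  this to $\phi X$ and using $\phi^3 = \phi$ yields $\nabla_{\phi X}\xi = 0$. As the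
  hypothesis concerns global vector fields and the conclusion is pointwise, every tangent vector
  has to be extended to a vector field, which is done with bump functions.
\<close>

section \<open>Calculus of smooth functions and bump functions\<close>

lemma Ck_on_has_derivative:
  assumes "Ck_on (Suc k) f S" "open S" "x \<in> S"
  shows "(f has_derivative frechet_derivative f (at x)) (at x)"
  using assms by (simp add: differentiable_on_eq_differentiable_at frechet_derivative_works)

text \<open>On an open set, pointwise equality is equality near each point, so the two functions
  have the same derivatives and the induction passes to these.\<close>

lemma Ck_on_cong_imp:
  assumes "open S" "\<And>x. x \<in> S \<Longrightarrow> f x = g x" "Ck_on k f S"
  shows "Ck_on k g S"
  using assms(2,3)
proof (induction k arbitrary: f g)
  case 0
  then show ?case by (auto cong: continuous_on_cong)
next
  case (Suc k)
  have g: "(g has_derivative frechet_derivative f (at x)) (at x)" if "x \<in> S" for x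
    using Ck_on_has_derivative[OF Suc.prems(2) assms(1) that] assms(1) that Suc.prems(1)
    by (rule has_derivative_transform_within_open)
  then have "frechet_derivative f (at x) = frechet_derivative g (at x)" if "x \<in> S" for x
    using that frechet_derivative_at by blast
  then have "Ck_on k (\<lambda>x. frechet_derivative g (at x) i) S" if "i \<in> Basis" for i
    using Suc.IH[of "\<lambda>x. frechet_derivative f (at x) i"] Suc.prems(2) that by simp
  moreover have "g differentiable_on S"
    using g assms(1) by (auto simp: differentiable_on_eq_differentiable_at differentiable_def)
  ultimately show ?case by simp
qed

lemma Ck_on_cong:
  assumes "open S" "\<And>x. x \<in> S \<Longrightarrow> f x = g x"
  shows "Ck_on k f S \<longleftrightarrow> Ck_on k g S"
  using Ck_on_cong_imp[OF assms(1), of f g] Ck_on_cong_imp[OF assms(1), of g f] assms(2) by auto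

text \<open>Derivatives are unique, so a formula \<open>f'\<close> obtained from the differentiation
  rules may stand in for \<open>frechet_derivative\<close>. The inductions for sums, products and
  compositions go through this rule.\<close>

lemma Ck_on_SucI:
  assumes "open S"
    and "\<And>x. x \<in> S \<Longrightarrow> (f has_derivative f' x) (at x)"
    and "\<And>i. i \<in> Basis \<Longrightarrow> Ck_on k (\<lambda>x. f' x i) S"
  shows "Ck_on (Suc k) f S"
proof -
  have *: "f' x = frechet_derivative f (at x)" if "x \<in> S" for x
    using assms(2)[OF that] by (rule frechet_derivative_at)
  have "Ck_on k (\<lambda>x. frechet_derivative f (at x) i) S" if "i \<in> Basis" for i
    by (rule Ck_on_cong_imp[OF assms(1) _ assms(3)[OF that]]) (simp add: *)
  moreover have "f differentiable_on S"
    using assms(1,2) by (auto simp: differentiable_on_eq_differentiable_at differentiable_def)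
  ultimately show ?thesis by simp
qed

lemma Ck_on_SucD: "Ck_on (Suc k) f S \<Longrightarrow> Ck_on k f S"
  by (induction k arbitrary: f) (auto intro: differentiable_imp_continuous_on)

lemma Ck_on_subset: "Ck_on k f S \<Longrightarrow> T \<subseteq> S \<Longrightarrow> Ck_on k f T"
  by (induction k arbitrary: f) (auto intro: continuous_on_subset differentiable_on_subset)

text \<open>Continuity, differentiability and the derivative at a point depend only on a
  neighbourhood. This later allows a function on the manifold to be checked by separate arguments
  inside and outside a chart domain.\<close>

lemma Ck_on_local:
  assumes "\<And>x. x \<in> S \<Longrightarrow> \<exists>T. open T \<and> x \<in> T \<and> Ck_on k f T"
  shows "Ck_on k f S"
  using assms
proof (induction k arbitrary: f)
  case 0
  have "isCont f x" if x: "x \<in> S" for x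
  proof -
    obtain T where "open T" "x \<in> T" "continuous_on T f"
      using 0[OF x] unfolding Ck_on.simps by blast
    then show ?thesis by (simp add: continuous_on_eq_continuous_at)
  qed
  then have "continuous_on S f" by (intro continuous_at_imp_continuous_on ballI)
  then show ?case unfolding Ck_on.simps .
next
  case (Suc k)
  have "f differentiable_on S"
    unfolding differentiable_on_def
  proof
    fix x assume "x \<in> S"
    with Suc.prems obtain T where "open T" "x \<in> T" "f differentiable_on T" by auto
    then show "f differentiable (at x within S)"
      by (simp add: differentiable_on_eq_differentiable_at differentiable_at_withinI)
  qed
  moreover have "Ck_on k (\<lambda>x. frechet_derivative f (at x) i) S" if "i \<in> Basis" for i
    using that Suc.prems by (intro Suc.IH) auto
  ultimately show ?case by simp
qed

lemma Ck_on_const: "Ck_on k (\<lambda>x. c) S"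
  by (induction k arbitrary: c) (auto simp: frechet_derivative_const)

lemma Ck_on_bounded_linear_compose:
  assumes "bounded_linear l" "open S" "Ck_on k f S"
  shows "Ck_on k (\<lambda>x. l (f x)) S"
  using assms(3)
proof (induction k arbitrary: f)
  case 0
  then show ?case using bounded_linear.continuous_on[OF assms(1)] by auto
next
  case (Suc k)
  show ?case
    by (rule Ck_on_SucI[OF assms(2)],
        rule bounded_linear.has_derivative[OF assms(1) Ck_on_has_derivative[OF Suc.prems assms(2)]])
      (use Suc in auto)
qed

lemma Ck_on_bounded_linear:
  assumes "bounded_linear l" "open S"
  shows "Ck_on k l S"
proof (cases k)
  case 0
  then show ?thesis using assms(1) by (simp add: linear_continuous_on)
next
  case (Suc k')
  then show ?thesis
    using Ck_on_SucI[OF assms(2) bounded_linear_imp_has_derivative[OF assms(1)]] Ck_on_const by blast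
qed

lemma Ck_on_add:
  assumes "open S" "Ck_on k f S" "Ck_on k g S"
  shows "Ck_on k (\<lambda>x. f x + g x) S"
  using assms(2,3)
proof (induction k arbitrary: f g)
  case 0
  then show ?case by (auto intro: continuous_on_add)
next
  case (Suc k)
  show ?case
    by (rule Ck_on_SucI[OF assms(1)],
        rule has_derivative_add[OF Suc.prems[THEN Ck_on_has_derivative, OF assms(1)]])
      (use Suc in auto)
qed

lemma Ck_on_sum:
  assumes "open S" "\<And>j. j \<in> J \<Longrightarrow> Ck_on k (f j) S"
  shows "Ck_on k (\<lambda>x. \<Sum>j\<in>J. f j x) S"
  using assms(2)
  by (induction J rule: infinite_finite_induct) (auto intro: Ck_on_const Ck_on_add[OF assms(1)])

lemma Ck_on_scaleR:
  fixes u :: "'a::euclidean_space \<Rightarrow> real"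
  assumes "open S" "Ck_on k u S" "Ck_on k f S"
  shows "Ck_on k (\<lambda>x. u x *\<^sub>R f x) S"
  using assms(2,3)
proof (induction k arbitrary: u f)
  case 0
  then show ?case by (auto intro: continuous_on_scaleR)
next
  case (Suc k)
  \<comment> \<open>The product rule also contains the undifferentiated factors, so these are needed
    at order \<open>k\<close> before the induction hypothesis applies.\<close>
  have "Ck_on k u S" "Ck_on k f S"
    using Suc.prems Ck_on_SucD by blast+
  then show ?case
    by - (rule Ck_on_SucI[OF assms(1)],
        rule has_derivative_scaleR[OF Suc.prems[THEN Ck_on_has_derivative, OF assms(1)]],
        use Suc in \<open>auto intro!: Ck_on_add[OF assms(1)]\<close>)
qed

lemma linear_eq_sum_Basis:
  fixes l :: "'a::euclidean_space \<Rightarrow> 'b::real_vector"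
  assumes "linear l"
  shows "l w = (\<Sum>i\<in>Basis. (w \<bullet> i) *\<^sub>R l i)"
  using linear_sum[OF assms, of "\<lambda>i. (w \<bullet> i) *\<^sub>R i" Basis]
  by (simp add: linear_scale[OF assms] euclidean_representation)

text \<open>In the chain rule both the linear map and its argument vary with the point. Expanding
  the argument in \<open>Basis\<close> turns the derivative into a sum of scalar components of the
  derivative of \<open>g\<close> times partial derivatives of \<open>f\<close> along
  \<open>g\<close>, which the induction hypothesis and the product rule cover.\<close>

lemma Ck_on_compose:
  fixes g :: "'a::euclidean_space \<Rightarrow> 'b::euclidean_space"
  assumes "open S" "open T" "g ` S \<subseteq> T" "Ck_on k g S" "Ck_on k f T"
  shows "Ck_on k (\<lambda>x. f (g x)) S"
  using assms(4,5)
proof (induction k arbitrary: f)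
  case 0
  then show ?case
    using continuous_on_compose2[of T f S g] assms(3) by simp
next
  case (Suc k)
  let ?f' = "\<lambda>y. frechet_derivative f (at y)" and ?g' = "\<lambda>x. frechet_derivative g (at x)"
  have f': "(f has_derivative ?f' (g x)) (at (g x))" if "x \<in> S" for x
    using Ck_on_has_derivative[OF Suc.prems(2) assms(2)] assms(3) that by blast
  have g': "(g has_derivative ?g' x) (at x)" if "x \<in> S" for x
    using Ck_on_has_derivative[OF Suc.prems(1) assms(1) that] .
  have *: "?f' (g x) w = (\<Sum>j\<in>Basis. (w \<bullet> j) *\<^sub>R ?f' (g x) j)" if "x \<in> S" for x w
    by (rule linear_eq_sum_Basis[OF has_derivative_linear[OF f'[OF that]]])
  show ?case
  proof (rule Ck_on_SucI[OF assms(1)])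
    show "((\<lambda>x. f (g x)) has_derivative (\<lambda>w. ?f' (g x) (?g' x w))) (at x)" if "x \<in> S" for x
      using has_derivative_compose[OF g'[OF that] f'[OF that]] .
  next
    fix i :: 'a assume i: "i \<in> Basis"
    have "Ck_on k (\<lambda>x. \<Sum>j\<in>Basis. (?g' x i \<bullet> j) *\<^sub>R ?f' (g x) j) S"
    proof (intro Ck_on_sum[OF assms(1)] Ck_on_scaleR[OF assms(1)])
      fix j :: 'b assume j: "j \<in> Basis"
      show "Ck_on k (\<lambda>x. ?g' x i \<bullet> j) S"
        using Ck_on_bounded_linear_compose[OF bounded_linear_inner_left assms(1)] Suc.prems(1) i
        by auto
      show "Ck_on k (\<lambda>x. ?f' (g x) j) S"
        using Suc.IH[OF Ck_on_SucD[OF Suc.prems(1)], of "\<lambda>y. ?f' y j"] Suc.prems(2) j by simp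
    qed
    then show "Ck_on k (\<lambda>x. ?f' (g x) (?g' x i)) S"
      by (rule Ck_on_cong_imp[OF assms(1), rotated]) (simp add: * [symmetric])
  qed
qed

section \<open>Smooth functions on open sets\<close>

lemma smooth_on_cong:
  assumes "open S" "\<And>x. x \<in> S \<Longrightarrow> f x = g x"
  shows "smooth_on f S \<longleftrightarrow> smooth_on g S"
  using Ck_on_cong[OF assms] by (simp add: smooth_on_def)

lemma smooth_on_local:
  assumes "\<And>x. x \<in> S \<Longrightarrow> \<exists>T. open T \<and> x \<in> T \<and> smooth_on f T"
  shows "smooth_on f S"
  using assms unfolding smooth_on_def by (meson Ck_on_local)

lemma smooth_on_const: "smooth_on (\<lambda>x. c) S"
  by (simp add: smooth_on_def Ck_on_const)

lemma smooth_on_bounded_linear: "bounded_linear l \<Longrightarrow> open S \<Longrightarrow> smooth_on l S"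
  by (simp add: smooth_on_def Ck_on_bounded_linear)

lemma smooth_on_add:
  "open S \<Longrightarrow> smooth_on f S \<Longrightarrow> smooth_on g S \<Longrightarrow> smooth_on (\<lambda>x. f x + g x) S"
  by (simp add: smooth_on_def Ck_on_add)

lemma smooth_on_sum:
  "open S \<Longrightarrow> (\<And>j. j \<in> J \<Longrightarrow> smooth_on (f j) S) \<Longrightarrow> smooth_on (\<lambda>x. \<Sum>j\<in>J. f j x) S"
  by (simp add: smooth_on_def Ck_on_sum)

lemma smooth_on_mult:
  fixes f g :: "'a::euclidean_space \<Rightarrow> real"
  shows "open S \<Longrightarrow> smooth_on f S \<Longrightarrow> smooth_on g S \<Longrightarrow> smooth_on (\<lambda>x. f x * g x) S"
  using Ck_on_scaleR[of S _ f g] by (simp add: smooth_on_def)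

lemma smooth_on_compose:
  fixes g :: "'a::euclidean_space \<Rightarrow> 'b::euclidean_space"
  assumes "open S" "open T" "g ` S \<subseteq> T" "smooth_on g S" "smooth_on f T"
  shows "smooth_on (\<lambda>x. f (g x)) S"
  using assms by (auto simp: smooth_on_def intro: Ck_on_compose)

lemma smooth_on_has_derivative:
  assumes "smooth_on f S" "open S" "x \<in> S"
  shows "(f has_derivative frechet_derivative f (at x)) (at x)"
  using assms Ck_on_has_derivative unfolding smooth_on_def by blast

text \<open>\<open>Ck_on\<close> controls the derivative in basis directions; linearity extends this
  to the arbitrary direction \<open>c\<close> that coordinate fields require.\<close>

lemma smooth_on_frechet_derivative:
  assumes "smooth_on f S" "open S"
  shows "smooth_on (\<lambda>x. frechet_derivative f (at x) c) S"
proof -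
  have "Ck_on k (\<lambda>x. frechet_derivative f (at x) c) S" for k
  proof -
    have "Ck_on k (\<lambda>x. \<Sum>i\<in>Basis. (c \<bullet> i) *\<^sub>R frechet_derivative f (at x) i) S"
    proof (intro Ck_on_sum[OF assms(2)] Ck_on_scaleR[OF assms(2)] Ck_on_const)
      fix i :: 'a assume "i \<in> Basis"
      moreover have "Ck_on (Suc k) f S" using assms(1) unfolding smooth_on_def by blast
      ultimately show "Ck_on k (\<lambda>x. frechet_derivative f (at x) i) S" by simp
    qed
    moreover have "(\<Sum>i\<in>Basis. (c \<bullet> i) *\<^sub>R frechet_derivative f (at x) i)
        = frechet_derivative f (at x) c" if "x \<in> S" for x
      using linear_eq_sum_Basis[OF has_derivative_linear[OF smooth_on_has_derivative[OF assms that]]]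
      by (rule sym)
    ultimately show ?thesis by (rule Ck_on_cong_imp[OF assms(2), rotated])
  qed
  then show ?thesis by (simp add: smooth_on_def)
qed

section \<open>A function flat at 0, and bump functions\<close>

text \<open>
  The derivatives of $e^{-1/t}$ extended by 0 to $t \le 0$ stay in the family
  $P(1/t)\,e^{-1/t}$ with polynomial $P$, which makes the induction on the order go through.
\<close>

definition flat_exp :: "real poly \<Rightarrow> real \<Rightarrow> real" where
  "flat_exp P t = (if t > 0 then poly P (inverse t) * exp (- inverse t) else 0)"

lemma poly_times_exp_minus_tendsto_0:
  "((\<lambda>u::real. poly P u * exp (- u)) \<longlongrightarrow> 0) at_top"
proof -
  have "((\<lambda>u. \<Sum>i\<le>degree P. coeff P i * (u ^ i / exp u)) \<longlongrightarrow> (\<Sum>i\<le>degree P. coeff P i * 0)) at_top"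
    by (intro tendsto_sum tendsto_mult tendsto_const tendsto_power_div_exp_0)
  then show ?thesis
    by (simp add: poly_altdef sum_divide_distrib exp_minus field_simps)
qed

text \<open>With s = 1/t, the derivative of P(s) e^(-s) in t is s^2 (P(s) - P'(s)) e^(-s), and
  \<open>[:0, 0, 1:]\<close> is the polynomial s^2. At t = 0 the difference quotient from the right
  is s P(s) e^(-s), which tends to 0 as s grows.\<close>

lemma flat_exp_has_real_derivative:
  "(flat_exp P has_real_derivative flat_exp ([:0, 0, 1:] * (P - pderiv P)) t) (at t)"
proof -
  consider "t > 0" | "t < 0" | "t = 0" by linarith
  then show ?thesis
  proof cases
    case 1
    have "((\<lambda>t. poly P (inverse t) * exp (- inverse t)) has_real_derivative
        flat_exp ([:0, 0, 1:] * (P - pderiv P)) t) (at t)"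
      using 1 by (auto intro!: derivative_eq_intros poly_DERIV[THEN DERIV_chain2]
          simp: flat_exp_def power2_eq_square algebra_simps)
    then show ?thesis
      by (rule has_field_derivative_transform_within_open[where S="{0<..}"])
        (use 1 in \<open>auto simp: flat_exp_def\<close>)
  next
    case 2
    have "((\<lambda>t. 0) has_real_derivative flat_exp ([:0, 0, 1:] * (P - pderiv P)) t) (at t)"
      using 2 by (auto simp: flat_exp_def)
    then show ?thesis
      by (rule has_field_derivative_transform_within_open[where S="{..<0}"])
        (use 2 in \<open>auto simp: flat_exp_def\<close>)
  next
    case 3
    have "((\<lambda>h. flat_exp P h / h) \<longlongrightarrow> 0) (at 0)"
      unfolding filterlim_at_split
    proof
      show "((\<lambda>h. flat_exp P h / h) \<longlongrightarrow> 0) (at_left 0)"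
        by (rule tendsto_eventually) (auto simp: eventually_at_filter flat_exp_def)
      have "((\<lambda>h::real. poly ([:0, 1:] * P) (inverse h) * exp (- inverse h)) \<longlongrightarrow> 0) (at_right 0)"
        by (rule filterlim_compose[OF poly_times_exp_minus_tendsto_0 filterlim_inverse_at_top_right])
      moreover have "\<forall>\<^sub>F h in at_right (0::real).
          poly ([:0, 1:] * P) (inverse h) * exp (- inverse h) = flat_exp P h / h"
        by (auto simp: eventually_at_filter flat_exp_def field_simps)
      ultimately show "((\<lambda>h. flat_exp P h / h) \<longlongrightarrow> 0) (at_right 0)"
        by (rule Lim_transform_eventually)
    qed
    then show ?thesis
      using 3 by (simp add: DERIV_def flat_exp_def)
  qed
qed

lemma smooth_on_flat_exp: "smooth_on (flat_exp P) S"
proof -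
  have "Ck_on k (flat_exp P) UNIV" for k
  proof (induction k arbitrary: P)
    case 0
    show ?case
      using flat_exp_has_real_derivative DERIV_isCont by (simp add: continuous_on_eq_continuous_at) blast
  next
    case (Suc k)
    show ?case
      by (rule Ck_on_SucI[OF open_UNIV
            flat_exp_has_real_derivative[THEN has_field_derivative_imp_has_derivative]])
        (use Suc in simp)
  qed
  then show ?thesis by (auto simp: smooth_on_def intro: Ck_on_subset)
qed

text \<open>\<open>flat_exp 1\<close> is e^(-1/t) for t > 0. The squared distance is polynomial in
  the coordinates, hence smooth at the centre as well.\<close>

definition bump :: "'a::euclidean_space \<Rightarrow> real \<Rightarrow> 'a \<Rightarrow> real" where
  "bump a r x = flat_exp 1 (r\<^sup>2 - (dist a x)\<^sup>2)"

lemma bump_eq_0: "0 \<le> r \<Longrightarrow> x \<notin> ball a r \<Longrightarrow> bump a r x = 0"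
  by (auto simp: bump_def flat_exp_def not_less power_mono)

lemma bump_center: "0 < r \<Longrightarrow> bump a r a > 0"
  by (simp add: bump_def flat_exp_def)

lemma smooth_on_bump:
  assumes "open S"
  shows "smooth_on (bump a r) S"
proof -
  have lin: "smooth_on (\<lambda>x. (x - a) \<bullet> i) S" for i
  proof -
    have "smooth_on (\<lambda>x. x \<bullet> i + (- (a \<bullet> i))) S"
      by (intro smooth_on_add smooth_on_const smooth_on_bounded_linear bounded_linear_inner_left assms)
    then show ?thesis by (simp add: inner_diff_left)
  qed
  have "smooth_on (\<lambda>x. \<Sum>i\<in>Basis. ((x - a) \<bullet> i) * ((x - a) \<bullet> i)) S"
    by (rule smooth_on_sum[OF assms smooth_on_mult[OF assms lin lin]])
  then have "smooth_on (\<lambda>x. (-1) * (\<Sum>i\<in>Basis. ((x - a) \<bullet> i) * ((x - a) \<bullet> i)) + r\<^sup>2) S"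
    by (intro smooth_on_add smooth_on_mult smooth_on_const assms)
  moreover have "(\<Sum>i\<in>Basis. ((x - a) \<bullet> i) * ((x - a) \<bullet> i)) = (dist a x)\<^sup>2" for x
    unfolding dist_norm norm_minus_commute[of a] power2_norm_eq_inner
    by (rule euclidean_inner[symmetric])
  ultimately have "smooth_on (\<lambda>x. r\<^sup>2 - (dist a x)\<^sup>2) S"
    by simp
  then show ?thesis
    using smooth_on_compose[OF assms open_UNIV _ _ smooth_on_flat_exp]
    unfolding bump_def by blast
qed


section \<open>The cross product on $R^7$\<close>

lemma exhaust_7:
  fixes x :: 7
  shows "x = 1 \<or> x = 2 \<or> x = 3 \<or> x = 4 \<or> x = 5 \<or> x = 6 \<or> x = 7"
proof (induct x)
  case (of_int z)
  then have "z = 0 \<or> z = 1 \<or> z = 2 \<or> z = 3 \<or> z = 4 \<or> z = 5 \<or> z = 6" by fastforce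
  then show ?case by auto
qed

lemma forall_7: "(\<forall>i::7. P i) \<longleftrightarrow> P 1 \<and> P 2 \<and> P 3 \<and> P 4 \<and> P 5 \<and> P 6 \<and> P 7"
  by (metis exhaust_7)

text \<open>The cross product of the model: in an orthonormal basis, raising the last index of
  \<open>phi0\<close> multiplies the k-th component by the sign of the k-th basis vector.\<close>

definition cross0 :: "real^7 \<Rightarrow> real^7 \<Rightarrow> real^7" where
  "cross0 x y = (\<chi> k. g0 (axis k 1) (axis k 1) * phi0 x y (axis k 1))"

lemma wedge3_expand:
  "wedge3 i j k x y z = (x$i * y$j - x$j * y$i) * z$k + (x$j * y$k - x$k * y$j) * z$i
     + (x$k * y$i - x$i * y$k) * z$j"
  by (simp add: wedge3_def det_3 algebra_simps)

lemma cross0_nth: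
  "cross0 x y $ 1 = (x$2 * y$7 - x$7 * y$2) + (x$3 * y$5 - x$5 * y$3) - (x$4 * y$6 - x$6 * y$4)"
  "cross0 x y $ 2 = - (x$1 * y$7 - x$7 * y$1) - (x$3 * y$6 - x$6 * y$3) - (x$4 * y$5 - x$5 * y$4)"
  "cross0 x y $ 3 = - (x$1 * y$5 - x$5 * y$1) + (x$2 * y$6 - x$6 * y$2) + (x$4 * y$7 - x$7 * y$4)"
  "cross0 x y $ 4 = (x$1 * y$6 - x$6 * y$1) + (x$2 * y$5 - x$5 * y$2) - (x$3 * y$7 - x$7 * y$3)"
  "cross0 x y $ 5 = - (x$1 * y$3 - x$3 * y$1) + (x$2 * y$4 - x$4 * y$2) + (x$6 * y$7 - x$7 * y$6)"
  "cross0 x y $ 6 = (x$1 * y$4 - x$4 * y$1) + (x$2 * y$3 - x$3 * y$2) - (x$5 * y$7 - x$7 * y$5)"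
  "cross0 x y $ 7 = - (x$1 * y$2 - x$2 * y$1) - (x$3 * y$4 - x$4 * y$3) + (x$5 * y$6 - x$6 * y$5)"
  by (simp_all add: cross0_def g0_def phi0_def wedge3_expand axis_def)

lemma g0_cross0: "g0 (cross0 x y) z = phi0 x y z"
  unfolding g0_def phi0_def wedge3_expand cross0_nth by algebra

lemma phi0_self: "phi0 x y x = 0"
  unfolding phi0_def wedge3_expand by algebra

text \<open>For a vector x of square -1 this identity becomes \<phi>^2 = I - \<eta> \<otimes> \<xi>
  in the model.\<close>

lemma cross0_cross0: "cross0 x (cross0 x y) = g0 x y *\<^sub>R x - g0 x x *\<^sub>R y"
  unfolding vec_eq_iff forall_7 vector_minus_component vector_scaleR_component real_scaleR_def g0_def cross0_nth
  by (intro conjI; algebra)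

lemma cross0_self [simp]: "cross0 x x = 0"
  unfolding vec_eq_iff forall_7 cross0_nth by simp

lemma g0_nondegenerate:
  assumes "\<And>z. g0 x z = 0"
  shows "x = 0"
  unfolding vec_eq_iff forall_7
  using assms[of "axis 1 1"] assms[of "axis 2 1"] assms[of "axis 3 1"] assms[of "axis 4 1"]
    assms[of "axis 5 1"] assms[of "axis 6 1"] assms[of "axis 7 1"]
  by (simp add: g0_def axis_def)

lemma g0_diff_left: "g0 (x - y) z = g0 x z - g0 y z"
  by (simp add: g0_def algebra_simps)

lemma g0_add_left: "g0 (x + y) z = g0 x z + g0 y z"
  by (simp add: g0_def algebra_simps)

lemma g0_scaleR_left: "g0 (a *\<^sub>R x) z = a * g0 x z"
  by (simp add: g0_def algebra_simps)

lemma g0_commute: "g0 x y = g0 y x"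
  by (simp add: g0_def mult.commute)


section \<open>Extension of tangent vectors\<close>

lemma smooth_atlas_chartD:
  assumes "smooth_atlas A" "(U, x) \<in> A"
  shows "open U" "open (x ` U)" "homeomorphism U (x ` U) x (inv_into U x)" "inj_on x U"
proof -
  have "is_chart (U, x)" using assms by (auto simp: smooth_atlas_def)
  then show "open U" "open (x ` U)" and hom: "homeomorphism U (x ` U) x (inv_into U x)"
    by (simp_all add: is_chart_def)
  show "inj_on x U"
    using homeomorphism_apply1[OF hom] by (rule inj_on_inverseI)
qed

lemma smooth_functionsD:
  "f \<in> smooth_functions A \<Longrightarrow> (U, x) \<in> A \<Longrightarrow> smooth_on (f \<circ> inv_into U x) (x ` U)"
  by (auto simp: smooth_functions_def)

lemma smooth_functionsI:
  "(\<And>U x. (U, x) \<in> A \<Longrightarrow> smooth_on (\<lambda>z. f (inv_into U x z)) (x ` U)) \<Longrightarrow> f \<in> smooth_functions A"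
  by (auto simp: smooth_functions_def comp_def)

lemma smooth_functions_const: "(\<lambda>p. c) \<in> smooth_functions A"
  by (auto simp: smooth_functions_def comp_def smooth_on_const)

lemma smooth_functions_add:
  assumes "smooth_atlas A" "f \<in> smooth_functions A" "h \<in> smooth_functions A"
  shows "(\<lambda>p. f p + h p) \<in> smooth_functions A"
  by (intro smooth_functionsI smooth_on_add smooth_atlas_chartD(2)[OF assms(1)]
      smooth_functionsD[OF assms(2), unfolded comp_def] smooth_functionsD[OF assms(3), unfolded comp_def])

lemma smooth_functions_mult:
  assumes "smooth_atlas A" "f \<in> smooth_functions A" "h \<in> smooth_functions A"
  shows "(\<lambda>p. f p * h p) \<in> smooth_functions A"
  by (intro smooth_functionsI smooth_on_mult smooth_atlas_chartD(2)[OF assms(1)]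
      smooth_functionsD[OF assms(2), unfolded comp_def] smooth_functionsD[OF assms(3), unfolded comp_def])

lemma tangent_space_linear:
  assumes "v \<in> tangent_space A p" "f \<in> smooth_functions A" "h \<in> smooth_functions A"
  shows "v (\<lambda>q. a * f q + b * h q) = a * v f + b * v h"
  using assms by (simp add: tangent_space_def)

lemma tangent_space_Leibniz:
  assumes "v \<in> tangent_space A p" "f \<in> smooth_functions A" "h \<in> smooth_functions A"
  shows "v (\<lambda>q. f q * h q) = v f * h p + f p * v h"
  using assms by (simp add: tangent_space_def)

lemma tangent_space_const:
  assumes "v \<in> tangent_space A p"
  shows "v (\<lambda>q. c) = 0"
proof -
  have "v (\<lambda>q. 1) = 0"
    using tangent_space_Leibniz[OF assms smooth_functions_const[of 1] smooth_functions_const[of 1]]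
    by simp
  then show ?thesis
    using tangent_space_linear[OF assms smooth_functions_const[of 1] smooth_functions_const[of 1], of c 0]
    by simp
qed

lemma zero_in_tangent_space: "(\<lambda>_. 0) \<in> tangent_space A p"
  by (simp add: tangent_space_def)

lemma tangent_space_lincomb:
  assumes "v \<in> tangent_space A p" "w \<in> tangent_space A p"
  shows "(\<lambda>f. a * v f + b * w f) \<in> tangent_space A p"
  using assms unfolding tangent_space_def by (auto simp: algebra_simps)

lemma vector_fieldsD:
  assumes "X \<in> vector_fields A"
  shows "X p \<in> tangent_space A p"
    and "f \<in> smooth_functions A \<Longrightarrow> (\<lambda>p. X p f) \<in> smooth_functions A"
  using assms by (auto simp: vector_fields_def)

lemma vector_fields_add_mult:
  assumes "smooth_atlas A" "X \<in> vector_fields A" "Y \<in> vector_fields A" "f \<in> smooth_functions A"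
  shows "(\<lambda>p h. X p h + f p * Y p h) \<in> vector_fields A"
  unfolding vector_fields_def
proof (intro CollectI conjI allI ballI)
  show "(\<lambda>h. X p h + f p * Y p h) \<in> tangent_space A p" for p
    using tangent_space_lincomb[OF vector_fieldsD(1)[OF assms(2)] vector_fieldsD(1)[OF assms(3)], of 1 p "f p"]
    by simp
  show "(\<lambda>p. X p h + f p * Y p h) \<in> smooth_functions A" if "h \<in> smooth_functions A" for h
    by (rule smooth_functions_add smooth_functions_mult assms(1,4) vector_fieldsD(2)[OF _ that] assms(2,3))+
qed

section \<open>Fields supported in a chart\<close>

text \<open>Around points of \<open>U\<close> the function is \<open>u\<close> composed with a
  transition map. Around points outside \<open>U\<close> it is zero: the preimage of
  \<open>K\<close> in \<open>U\<close> is compact, hence closed because the manifold is Hausdorff,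
  and the function vanishes off it.\<close>

lemma chart_extension_smooth:
  fixes A :: "('m::t2_space) chart set"
  assumes "smooth_atlas A" "(U, x) \<in> A" "smooth_on u (x ` U)"
    and "compact K" "K \<subseteq> x ` U" "\<And>z. z \<in> x ` U - K \<Longrightarrow> u z = 0"
  shows "(\<lambda>q. if q \<in> U then u (x q) else 0) \<in> smooth_functions A"
proof (rule smooth_functionsI)
  fix V y assume Vy: "(V, y) \<in> A"
  let ?f = "\<lambda>z. if inv_into V y z \<in> U then u (x (inv_into V y z)) else 0"
  note U = smooth_atlas_chartD[OF assms(1,2)] and V = smooth_atlas_chartD[OF assms(1) Vy]
  have open_image: "open (y ` (V \<inter> T))" if "open T" for T
    using homeomorphism_imp_open_map[OF V(3) openin_open_Int[OF that]] V(2) openin_open_trans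
    by blast
  define K' where "K' = inv_into U x ` K"
  have "continuous_on K (inv_into U x)"
    using homeomorphism_cont2[OF U(3)] assms(5) continuous_on_subset by blast
  then have "closed K'"
    unfolding K'_def using assms(4) compact_continuous_image compact_imp_closed by blast
  have K': "x q \<notin> K" if "q \<in> U" "q \<notin> K'" for q
    using that inv_into_f_f[OF U(4) that(1)] unfolding K'_def by (metis imageI)
  have K'U: "K' \<subseteq> U"
    unfolding K'_def using assms(5) inv_into_into[of _ x U] by blast
  show "smooth_on ?f (y ` V)"
  proof (rule smooth_on_local)
    fix z assume "z \<in> y ` V"
    then obtain q where q: "q \<in> V" "z = y q" by blast
    show "\<exists>T. open T \<and> z \<in> T \<and> smooth_on ?f T"
    proof (cases "q \<in> U")
      case True
      let ?T = "y ` (V \<inter> U)"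
      have T: "open ?T" using open_image[OF U(1)] .
      have "smooth_on (\<lambda>z. u (transition (V, y) (U, x) z)) ?T"
      proof (rule smooth_on_compose[OF T U(2)])
        show "transition (V, y) (U, x) ` y ` (V \<inter> U) \<subseteq> x ` U"
          using inv_into_f_f[OF V(4)] by (auto simp: transition_def)
        show "smooth_on (transition (V, y) (U, x)) (y ` (V \<inter> U))"
          using assms(1,2) Vy unfolding smooth_atlas_def by (metis fst_conv snd_conv)
      qed (rule assms(3))
      then have "smooth_on ?f ?T"
        by (rule smooth_on_cong[OF T, THEN iffD1, rotated])
          (use inv_into_f_f[OF V(4)] in \<open>auto simp: transition_def\<close>)
      then show ?thesis using T True q by blast
    next
      case False
      \<comment> \<open>This neighbourhood may reach into \<open>U\<close>, but only at points whose
        coordinates lie outside \<open>K\<close>, where \<open>u\<close> is zero.\<close>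
      let ?T = "y ` (V \<inter> - K')"
      have T: "open ?T" using open_image \<open>closed K'\<close> by blast
      have "?f z' = 0" if "z' \<in> ?T" for z'
        using that inv_into_f_f[OF V(4)] K' assms(6) by auto
      then have "smooth_on ?f ?T"
        using smooth_on_cong[OF T, of ?f "\<lambda>_. 0"] smooth_on_const by blast
      moreover have "z \<in> ?T" using False K'U q by blast
      ultimately show ?thesis using T by blast
    qed
  qed
qed

text \<open>
  The coordinate field \<open>u \<cdot> \<partial>\<^sub>e\<close>; on non-smooth functions it vanishes, as tangent vectors do by convention.
\<close>

definition chart_field ::
  "('m::topological_space) chart set \<Rightarrow> 'm chart \<Rightarrow> (real^7 \<Rightarrow> real) \<Rightarrow> real^7 \<Rightarrow> 'm vfield" where
  "chart_field A c u e q f = (if q \<in> fst c \<and> f \<in> smooth_functions A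
     then u (snd c q) * frechet_derivative (f \<circ> inv_into (fst c) (snd c)) (at (snd c q)) e else 0)"

lemma chart_field_vector_field:
  fixes A :: "('m::t2_space) chart set"
  assumes "smooth_atlas A" "(U, x) \<in> A" "smooth_on u (x ` U)"
    and "compact K" "K \<subseteq> x ` U" "\<And>z. z \<in> x ` U - K \<Longrightarrow> u z = 0"
  shows "chart_field A (U, x) u e \<in> vector_fields A"
  unfolding vector_fields_def
proof (intro CollectI conjI allI ballI)
  note U = smooth_atlas_chartD[OF assms(1,2)]
  have der: "(f \<circ> inv_into U x has_derivative frechet_derivative (f \<circ> inv_into U x) (at (x q))) (at (x q))"
    if "f \<in> smooth_functions A" "q \<in> U" for f q
    using smooth_on_has_derivative[OF smooth_functionsD[OF that(1) assms(2)] U(2)] that(2) by blast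
  fix q
  show "chart_field A (U, x) u e q \<in> tangent_space A q"
  proof (cases "q \<in> U")
    case False
    then show ?thesis by (auto simp: chart_field_def [abs_def] zero_in_tangent_space)
  next
    case True
    then have q: "inv_into U x (x q) = q" using U(4) by simp
    show ?thesis
      unfolding tangent_space_def
    proof (intro CollectI conjI allI ballI impI)
      fix f h and a b :: real assume fh: "f \<in> smooth_functions A" "h \<in> smooth_functions A"
      note df = der[OF fh(1) True] and dh = der[OF fh(2) True]
      have s: "(\<lambda>q. a * f q + b * h q) \<in> smooth_functions A"
        by (intro smooth_functions_add smooth_functions_mult smooth_functions_const fh assms(1))
      show "chart_field A (U, x) u e q (\<lambda>q. a * f q + b * h q)
          = a * chart_field A (U, x) u e q f + b * chart_field A (U, x) u e q h"
        using frechet_derivative_at[OF has_derivative_add[OF has_derivative_mult_right[OF df, of a]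
              has_derivative_mult_right[OF dh, of b]], symmetric] True s fh
        by (simp add: chart_field_def comp_def algebra_simps)
    next
      fix f h assume fh: "f \<in> smooth_functions A" "h \<in> smooth_functions A"
      note df = der[OF fh(1) True] and dh = der[OF fh(2) True]
      have s: "(\<lambda>q. f q * h q) \<in> smooth_functions A"
        by (intro smooth_functions_mult fh assms(1))
      show "chart_field A (U, x) u e q (\<lambda>q. f q * h q)
          = chart_field A (U, x) u e q f * h q + f q * chart_field A (U, x) u e q h"
        using frechet_derivative_at[OF has_derivative_mult[OF df dh], symmetric] True s fh q
        by (simp add: chart_field_def comp_def algebra_simps)
    qed (simp add: chart_field_def)
  qed
next
  fix f assume f: "f \<in> smooth_functions A"
  note U = smooth_atlas_chartD[OF assms(1,2)]
  \<comment> \<open>The factor \<open>u\<close> makes this product vanish outside \<open>K\<close>,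
    so its extension by zero is smooth.\<close>
  let ?w = "\<lambda>z. u z * frechet_derivative (f \<circ> inv_into U x) (at z) e"
  have "smooth_on ?w (x ` U)"
    by (intro smooth_on_mult smooth_on_frechet_derivative smooth_functionsD[OF f assms(2)] assms(3) U(2))
  then have "(\<lambda>q. if q \<in> U then ?w (x q) else 0) \<in> smooth_functions A"
    by (rule chart_extension_smooth[OF assms(1,2) _ assms(4,5)]) (simp add: assms(6))
  then show "(\<lambda>q. chart_field A (U, x) u e q f) \<in> smooth_functions A"
    using f by (simp add: chart_field_def cong: if_cong)
qed

text \<open>
  The frame enters only through the dimension of the tangent space: the seven cut-off coordinate
  fields are independent at \<open>p\<close>, hence span, and Hadamard's lemma is not needed.
\<close>

lemma tangent_vector_extends_to_vector_field:
  fixes A :: "('m::t2_space) chart set"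
  assumes "smooth_atlas A" and L: "tangent_linear A p L" "bij_betw L (tangent_space A p) (UNIV :: (real^7) set)"
    and "v \<in> tangent_space A p"
  obtains X where "X \<in> vector_fields A" "X p = v"
proof -
  have "p \<in> (\<Union>c\<in>A. fst c)" using assms(1) unfolding smooth_atlas_def by blast
  then obtain U x where Ux: "(U, x) \<in> A" "p \<in> U" by auto
  note U = smooth_atlas_chartD[OF assms(1) Ux(1)]
  obtain r where r: "0 < r" "cball (x p) r \<subseteq> x ` U"
    using open_contains_cball_eq[OF U(2)] Ux(2) by blast
  let ?u = "bump (x p) r"
  have u0: "?u z = 0" if "z \<in> x ` U - cball (x p) r" for z
    using that r(1) by (intro bump_eq_0) auto
  have VF: "chart_field A (U, x) ?u e \<in> vector_fields A" for e
    by (rule chart_field_vector_field[OF assms(1) Ux(1) smooth_on_bump compact_cball r(2) u0])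
      (auto intro: U(2))
  let ?T = "\<lambda>e. L (chart_field A (U, x) ?u e p)"
  have TS: "chart_field A (U, x) ?u e p \<in> tangent_space A p" for e
    using VF vector_fieldsD(1) by blast
  have der: "linear (frechet_derivative (f \<circ> inv_into U x) (at (x p)))"
    if "f \<in> smooth_functions A" for f
    using smooth_on_has_derivative[OF smooth_functionsD[OF that Ux(1)] U(2)] Ux(2)
      has_derivative_linear by blast
  \<comment> \<open>An equality of HOL functions: on non-smooth \<open>f\<close> all terms are 0 by
    the convention for tangent vectors.\<close>
  have lin: "chart_field A (U, x) ?u (a *\<^sub>R c + b *\<^sub>R d) p =
     (\<lambda>f. a * chart_field A (U, x) ?u c p f + b * chart_field A (U, x) ?u d p f)" for a b c d
    by (auto simp: fun_eq_iff chart_field_def linear_add[OF der] linear_scale[OF der] algebra_simps)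
  have T: "?T (a *\<^sub>R c + b *\<^sub>R d) = a *\<^sub>R ?T c + b *\<^sub>R ?T d" for a b c d
    using L(1) TS unfolding lin tangent_linear_def by blast
  have "linear ?T"
  proof (rule linearI)
    show "?T (c + d) = ?T c + ?T d" for c d using T[of 1 c 1 d] by simp
    show "?T (a *\<^sub>R c) = a *\<^sub>R ?T c" for a c using T[of a c 0 0] by simp
  qed
  \<comment> \<open>\<open>?T e = 0\<close> is tested on the cut-off linear function with differential \<open>bump \<cdot> e\<close> at \<open>p\<close>.\<close>
  moreover have "e = 0" if "?T e = 0" for e
  proof -
    have "?T e = L (\<lambda>_. 0)"
      using that L(1)[unfolded tangent_linear_def, rule_format,
          OF zero_in_tangent_space zero_in_tangent_space, of 0 0] by simp
    then have e0: "chart_field A (U, x) ?u e p = (\<lambda>_. 0)"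
      using L(2) TS zero_in_tangent_space unfolding bij_betw_def inj_on_def by blast
    let ?w = "\<lambda>z. ?u z * ((z - x p) \<bullet> e)"
    let ?h = "\<lambda>q. if q \<in> U then ?u (x q) * ((x q - x p) \<bullet> e) else 0"
    have "smooth_on (\<lambda>z. z \<bullet> e + (- (x p \<bullet> e))) (x ` U)"
      by (intro smooth_on_add smooth_on_const smooth_on_bounded_linear bounded_linear_inner_left U(2))
    then have "smooth_on ?w (x ` U)"
      by (intro smooth_on_mult smooth_on_bump U(2)) (simp add: inner_diff_left)
    then have h: "?h \<in> smooth_functions A"
      by (rule chart_extension_smooth[OF assms(1) Ux(1) _ compact_cball r(2)]) (simp add: u0)
    have du: "(?u has_derivative frechet_derivative ?u (at (x p))) (at (x p))"
      by (rule smooth_on_has_derivative[OF smooth_on_bump[OF open_UNIV] open_UNIV UNIV_I])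
    have "((\<lambda>z. (z - x p) \<bullet> e) has_derivative (\<lambda>d. d \<bullet> e)) (at (x p))"
      by (auto intro!: derivative_eq_intros)
    \<comment> \<open>The linear factor vanishes at \<open>x p\<close>, so the term with the
      derivative of the bump drops out.\<close>
    from has_derivative_mult[OF du this]
    have "(?w has_derivative (\<lambda>d. ?u (x p) * (d \<bullet> e))) (at (x p))"
      by simp
    then have "(?h \<circ> inv_into U x has_derivative (\<lambda>d. ?u (x p) * (d \<bullet> e))) (at (x p))"
      by (rule has_derivative_transform_within_open[OF _ U(2)])
        (use Ux(2) inv_into_f_f[OF U(4)] in auto)
    from frechet_derivative_at[OF this]
    have "frechet_derivative (?h \<circ> inv_into U x) (at (x p)) e = ?u (x p) * (e \<bullet> e)"
      by (rule fun_cong[symmetric])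
    \<comment> \<open>The bump enters twice, as coefficient of the field and as cut-off of the test
      function. Its value at the centre is positive, so \<open>e \<bullet> e\<close> must be
      0.\<close>
    then have "chart_field A (U, x) ?u e p ?h = ?u (x p) * (?u (x p) * (e \<bullet> e))"
      using h Ux(2) by (simp add: chart_field_def)
    then show "e = 0"
      using e0 bump_center[OF r(1), of "x p"] by simp
  qed
  ultimately have "inj ?T"
    by (simp add: linear_injective_0)
  then have "surj ?T"
    by (rule linear_injective_imp_surjective[OF \<open>linear ?T\<close>]) (rule refl)
  then obtain e where "L v = ?T e" by (rule surjE)
  then have "chart_field A (U, x) ?u e p = v"
    using L(2) TS assms(4) unfolding bij_betw_def by (metis inj_onD)
  then show ?thesis using VF that by blast
qed


section \<open>The structure induced by a unit field\<close>

text \<open>The same choice as inside \<open>g43\<close>, so the metric is \<open>g0\<close> in this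
  frame by unfolding.\<close>

definition g2star_frame_at :: "('m::topological_space) chart set \<Rightarrow> 'm form3 \<Rightarrow> 'm \<Rightarrow> 'm tvec \<Rightarrow> real^7" where
  "g2star_frame_at A \<omega> p = (SOME L. g2star_frame A \<omega> p L)"

locale g2star_unit_field =
  fixes A :: "('m::t2_space) chart set" and \<omega> :: "'m form3" and \<xi> :: "'m vfield"
  assumes atlas: "smooth_atlas A"
    and g2star: "g2star_structure A \<omega>"
    and xi: "\<xi> \<in> vector_fields A"
    and xi_unit: "g43 A \<omega> p (\<xi> p) (\<xi> p) = -1"
begin

abbreviation T where "T \<equiv> tangent_space A"
abbreviation L where "L \<equiv> g2star_frame_at A \<omega>"
abbreviation \<phi> where "\<phi> \<equiv> para_phi A \<omega> \<xi>"
abbreviation g where "g \<equiv> para_metric A \<omega>"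
abbreviation \<eta> where "\<eta> \<equiv> para_eta A \<omega> \<xi>"

section \<open>Transport to the linear model\<close>

lemma frame: "g2star_frame A \<omega> p (L p)"
  using g2star unfolding g2star_structure_def g2star_frame_at_def by (metis someI_ex)

lemma frame_bij: "bij_betw (L p) (T p) UNIV"
  and frame_tangent_linear: "tangent_linear A p (L p)"
  using frame[of p] by (auto simp: g2star_frame_def)

lemma frame_lincomb:
  "v \<in> T p \<Longrightarrow> w \<in> T p \<Longrightarrow> L p (\<lambda>f. a * v f + b * w f) = a *\<^sub>R L p v + b *\<^sub>R L p w"
  using frame_tangent_linear unfolding tangent_linear_def by blast

lemma frame_add_scaleR:
  "v \<in> T p \<Longrightarrow> w \<in> T p \<Longrightarrow> L p (\<lambda>f. v f + b * w f) = L p v + b *\<^sub>R L p w"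
  using frame_lincomb[of v p w 1 b] by simp

lemma frame_inj: "v \<in> T p \<Longrightarrow> w \<in> T p \<Longrightarrow> L p v = L p w \<Longrightarrow> v = w"
  using frame_bij unfolding bij_betw_def by (metis inj_onD)

lemma frame_surj: obtains v where "v \<in> T p" "L p v = x"
  using frame_bij[of p] unfolding bij_betw_def by (metis UNIV_I imageE)

lemma form_frame: "u \<in> T p \<Longrightarrow> v \<in> T p \<Longrightarrow> w \<in> T p \<Longrightarrow> \<omega> p u v w = phi0 (L p u) (L p v) (L p w)"
  using frame[of p] by (simp add: g2star_frame_def)

lemma g43_frame: "g43 A \<omega> p v w = g0 (L p v) (L p w)"
  by (simp add: g43_def g2star_frame_at_def Let_def)

lemma g0_xi: "g0 (L p (\<xi> p)) (L p (\<xi> p)) = -1"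
  using xi_unit[of p] by (simp add: g43_frame)

lemma metric_frame: "g p v w = - g0 (L p v) (L p w)"
  by (simp add: para_metric_def g43_frame)

text \<open>Justifies the definite description in \<open>cross_product\<close>: surjectivity of the
  frame gives existence, nondegeneracy of \<open>g0\<close> gives uniqueness.\<close>

lemma cross_product_frame:
  assumes "u \<in> T p" "v \<in> T p"
  shows "cross_product A \<omega> p u v \<in> T p \<and> L p (cross_product A \<omega> p u v) = cross0 (L p u) (L p v)"
proof -
  obtain w where w: "w \<in> T p" "L p w = cross0 (L p u) (L p v)" by (rule frame_surj)
  have "cross_product A \<omega> p u v = w"
    unfolding cross_product_def
  proof (rule the_equality)
    show "w \<in> T p \<and> (\<forall>z\<in>T p. \<omega> p u v z = g43 A \<omega> p w z)"
      using w assms by (simp add: form_frame g43_frame g0_cross0)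
  next
    fix w' assume w': "w' \<in> T p \<and> (\<forall>z\<in>T p. \<omega> p u v z = g43 A \<omega> p w' z)"
    have "g0 (L p w' - L p w) x = 0" for x
    proof -
      obtain z where z: "z \<in> T p" "L p z = x" by (rule frame_surj)
      then have "phi0 (L p u) (L p v) x = g0 (L p w') x"
        using w' assms form_frame g43_frame by metis
      then show ?thesis by (simp add: g0_diff_left w(2) g0_cross0)
    qed
    then have "L p w' = L p w" using g0_nondegenerate by fastforce
    then show "w' = w" using frame_inj w' w by blast
  qed
  then show ?thesis using w by simp
qed

section \<open>Identities of the almost paracontact structure\<close>

lemma phi_tangent: "v \<in> T p \<Longrightarrow> \<phi> p v \<in> T p"
  and phi_frame: "v \<in> T p \<Longrightarrow> L p (\<phi> p v) = cross0 (L p (\<xi> p)) (L p v)"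
  using cross_product_frame[OF vector_fieldsD(1)[OF xi]] by (auto simp: para_phi_def)

lemma phi_phi:
  assumes "v \<in> T p"
  shows "\<phi> p (\<phi> p v) = (\<lambda>f. v f - \<eta> p v * \<xi> p f)"
proof -
  have *: "(\<lambda>f. v f - \<eta> p v * \<xi> p f) = (\<lambda>f. 1 * v f + (- \<eta> p v) * \<xi> p f)"
    by simp
  show ?thesis
    unfolding *
    by (intro frame_inj[of _ p] phi_tangent tangent_space_lincomb)
      (simp_all add: assms vector_fieldsD(1)[OF xi] phi_tangent phi_frame frame_add_scaleR
        cross0_cross0 g0_xi para_eta_def metric_frame)
qed

lemma metric_phi_xi: "v \<in> T p \<Longrightarrow> g p (\<phi> p v) (\<xi> p) = 0"
  by (simp add: metric_frame phi_frame g0_cross0 phi0_self)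

lemma eta_phi: "v \<in> T p \<Longrightarrow> \<eta> p (\<phi> p v) = 0"
  using metric_phi_xi[of v p] by (simp add: para_eta_def metric_frame g0_commute)

lemma phi_phi_phi: "v \<in> T p \<Longrightarrow> \<phi> p (\<phi> p (\<phi> p v)) = \<phi> p v"
  by (simp add: phi_phi[OF phi_tangent] eta_phi)

lemma phi_xi: "\<phi> p (\<xi> p) = (\<lambda>_. 0)"
proof (rule frame_inj)
  show "\<phi> p (\<xi> p) \<in> T p" by (intro phi_tangent vector_fieldsD(1)[OF xi])
  have "L p (\<lambda>_. 0) = 0"
    using frame_lincomb[OF zero_in_tangent_space zero_in_tangent_space, of p 0 0] by simp
  then show "L p (\<phi> p (\<xi> p)) = L p (\<lambda>_. 0)"
    by (simp add: phi_frame vector_fieldsD(1)[OF xi])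
qed (rule zero_in_tangent_space)

text \<open>By \<open>phi_phi\<close> the field is X - \<eta>(X) \<xi>, and \<eta>(X) = g(\<xi>, X)
  is smooth because the metric is.\<close>

lemma phi_phi_vector_field:
  assumes "semi_riemannian_metric A g" "X \<in> vector_fields A"
  shows "(\<lambda>p. \<phi> p (\<phi> p (X p))) \<in> vector_fields A"
proof -
  have "(\<lambda>p. \<eta> p (X p)) \<in> smooth_functions A"
    using assms xi unfolding semi_riemannian_metric_def para_eta_def by blast
  then have "(\<lambda>p. (-1) * \<eta> p (X p)) \<in> smooth_functions A"
    by (rule smooth_functions_mult[OF atlas smooth_functions_const])
  from vector_fields_add_mult[OF atlas assms(2) xi this] show ?thesis
    by (simp add: phi_phi vector_fieldsD(1)[OF assms(2)])
qed

section \<open>The covariant derivative of \<xi>\<close>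

text \<open>\<Phi>(., \<xi>) = 0 by \<open>metric_phi_xi\<close>. Hence the first term of the
  covariant derivative differentiates the zero function and the second vanishes, leaving -\<Phi>(Y,
  D_X \<xi>).\<close>

lemma F_xi:
  assumes "affine_connection A D" "X \<in> vector_fields A" "Y \<in> vector_fields A"
  shows "para_F A \<omega> \<xi> D X Y \<xi> p = - g p (\<phi> p (Y p)) (D p (X p) \<xi>)"
proof -
  have "D p (X p) Y \<in> T p"
    using assms unfolding affine_connection_def by (blast intro: vector_fieldsD(1))
  then show ?thesis
    by (simp add: para_F_def cov_deriv2_def para_Phi_def metric_phi_xi vector_fieldsD(1)[OF assms(3)]
        tangent_space_const[OF vector_fieldsD(1)[OF assms(2)]])
qed

text \<open>
  Smoothness of \<open>\<phi> X\<close> is never needed: \<open>\<phi>\<^sup>2 X = X - \<eta>(X) \<xi>\<close> is visibly smooth, and an extension \<open>X'\<close>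
  of the single vector \<open>\<phi> v\<close> gives the field \<open>\<phi>\<^sup>2 X'\<close> with value \<open>\<phi>\<^sup>3 v = \<phi> v\<close> at \<open>p\<close>.
\<close>

lemma D_phi_xi_eq_0:
  assumes D: "levi_civita_connection A g D"
    and W2: "\<And>X Y Z p. X \<in> vector_fields A \<Longrightarrow> Y \<in> vector_fields A \<Longrightarrow> Z \<in> vector_fields A \<Longrightarrow>
           para_F_W2 A \<omega> \<xi> D X Y Z p = 0"
    and v: "v \<in> T p"
  shows "D p (\<phi> p v) \<xi> = (\<lambda>_. 0)"
proof -
  have metric: "semi_riemannian_metric A g" and conn: "affine_connection A D"
    and compat: "metric_compatible A g D"
    using D by (auto simp: levi_civita_connection_def)
  let ?W = "D p (\<phi> p v) \<xi>"
  obtain X' where X': "X' \<in> vector_fields A" "X' p = \<phi> p v"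
    using tangent_vector_extends_to_vector_field[OF atlas frame_tangent_linear frame_bij phi_tangent[OF v]] .
  define X where "X = (\<lambda>q. \<phi> q (\<phi> q (X' q)))"
  have X: "X \<in> vector_fields A" "X p = \<phi> p v"
    using phi_phi_vector_field[OF metric X'(1)] X'(2) phi_phi_phi[OF v] by (simp_all add: X_def)
  have W: "?W \<in> T p"
    using conn xi phi_tangent[OF v] unfolding affine_connection_def by blast
  have eta_xi: "\<eta> p (\<xi> p) = 1"
    by (simp add: para_eta_def metric_frame g0_xi)
  have phi_W: "g p (\<phi> p u) ?W = 0" if u: "u \<in> T p" for u
  proof -
    obtain Y' where Y': "Y' \<in> vector_fields A" "Y' p = u"
      using tangent_vector_extends_to_vector_field[OF atlas frame_tangent_linear frame_bij u] .
    \<comment> \<open>Inserting \<phi>^2 Z into \<open>F_xi\<close> produces \<phi>^3 Z, which is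
      \<phi> Z.\<close>
    have F: "para_F A \<omega> \<xi> D X (\<lambda>q. \<phi> q (\<phi> q (Z q))) \<xi> p = - g p (\<phi> p (Z p)) ?W"
      if "Z \<in> vector_fields A" for Z
      using F_xi[OF conn X(1) phi_phi_vector_field[OF metric that]] X(2)
      by (simp add: phi_phi_phi vector_fieldsD(1)[OF that])
    have "g p (\<lambda>_. 0) ?W = 0"
      using frame_lincomb[OF zero_in_tangent_space zero_in_tangent_space, of p 0 0]
      by (simp add: metric_frame g0_def)
    \<comment> \<open>With \<xi> in the last slot, the first summand of \<open>para_F_W2\<close>
      contains \<phi> \<xi> = 0, while \<eta>(\<xi>) = 1 isolates the second.\<close>
    then show ?thesis
      using W2[OF X'(1) Y'(1) xi, of p] F[OF xi] F[OF Y'(1)] Y'(2)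
      by (simp add: para_F_W2_def Let_def eta_xi phi_xi flip: X_def)
  qed
  have "g p u ?W = 0" if u: "u \<in> T p" for u
  proof -
    have "\<xi> p \<in> T p" using vector_fieldsD(1)[OF xi] .
    have "X p (\<lambda>q. g q (\<xi> q) (\<xi> q)) = 0"
      using tangent_space_const[OF vector_fieldsD(1)[OF X(1)]] by (simp add: metric_frame g0_xi)
    moreover have "X p (\<lambda>q. g q (\<xi> q) (\<xi> q)) = g p ?W (\<xi> p) + g p (\<xi> p) ?W"
      using compat X(1) xi unfolding metric_compatible_def X(2)[symmetric] by blast
    ultimately have xi_W: "g p (\<xi> p) ?W = 0"
      by (simp add: metric_frame g0_commute)
    \<comment> \<open>The splitting u = \<phi>^2 u + \<eta>(u) \<xi> separates the part covered by
      \<open>phi_W\<close> from the part covered by \<open>xi_W\<close>.\<close>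
    have "L p u = L p (\<lambda>f. \<phi> p (\<phi> p u) f + \<eta> p u * \<xi> p f)"
      by (simp add: phi_phi[OF u])
    then have "L p u = L p (\<phi> p (\<phi> p u)) + \<eta> p u *\<^sub>R L p (\<xi> p)"
      by (simp only: frame_add_scaleR[OF phi_tangent[OF phi_tangent[OF u]] \<open>\<xi> p \<in> T p\<close>])
    then show ?thesis
      using xi_W phi_W[OF phi_tangent[OF u]]
      by (simp add: metric_frame g0_add_left g0_scaleR_left)
  qed
  then show ?thesis
    using metric W unfolding semi_riemannian_metric_def by metis
qed

end

theorem theorem5:
  fixes A :: "('m::{t2_space, second_countable_topology}) chart set"
    and \<omega> :: "'m form3" and \<xi> :: "'m vfield" and D :: "'m connection"
  assumes "oriented_smooth_atlas A"
    and "g2star_structure A \<omega>"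
    and "\<xi> \<in> vector_fields A"
    and "\<And>p. g43 A \<omega> p (\<xi> p) (\<xi> p) = -1"
    and "levi_civita_connection A (para_metric A \<omega>) D"
    and "\<And>X Y Z p. X \<in> vector_fields A \<Longrightarrow> Y \<in> vector_fields A \<Longrightarrow> Z \<in> vector_fields A \<Longrightarrow>
           para_F_W2 A \<omega> \<xi> D X Y Z p = 0"
  shows "\<forall>X\<in>vector_fields A. \<forall>p. D p (para_phi A \<omega> \<xi> p (X p)) \<xi> = (\<lambda>_. 0)"
proof (intro ballI allI)
  fix X p assume X: "X \<in> vector_fields A"
  interpret g2star_unit_field A \<omega> \<xi>
    using assms by unfold_locales (auto simp: oriented_smooth_atlas_def)
  show "D p (para_phi A \<omega> \<xi> p (X p)) \<xi> = (\<lambda>_. 0)"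
    by (rule D_phi_xi_eq_0[OF assms(5,6) vector_fieldsD(1)[OF X]])
qed

end
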